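(* For all positive integers $n,k$ and $m$ with $1 \leq m \leq n-2$ and $1 \leq k \leq n-1$, there is a bijection $\Phi$ between the set $\mathcal{P}^{DU}_{n,m+1,k} \cup \mathcal{P}^{UD}_{n,m+1,k+1}$ and the set $\mathcal{P}^{DU}_{n,m,k} \cup \mathcal{P}^{UD}_{n,m,k+1}$.
   Context: Let $\mathcal{L}_n$ be the set of lattice paths in $\mathbb{Z}\times\mathbb{Z}$ from $(0,0)$ to $(n,n)$ using up steps $U=(0,1)$ and down steps $D=(1,0)$. A path is identified with a word of length $2n$ in the letters $U, D$ (with $n$ of each). An up step lies below the line $y=x$ if it goes from $(a,b)$ to $(a,b+1)$ with $b<a$. An $(n,m)$-Dyck path is a path in $\mathcal{L}_n$ with exactly $m$ up steps below the line $y=x$. A peak of a path is an occurrence of two consecutive steps $UD$. $\mathcal{P}_{n,m,k}$ denotes the set of all $(n,m)$-Dyck paths with exactly $k$ peaks. For $A,B\in\{U,D\}$, $\mathcal{P}^{AB}_{n,m,k}$ denotes the set of paths in $\mathcal{P}_{n,m,k}$ whose first step is $A$ and whose last step is $B$. *)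

theory Defs
  imports Main
begin

datatype step = U | D

text \<open>
  A lattice path starting at the origin is represented by the word of its steps, where
  \<open>U\<close> is the step (0,1) and \<open>D\<close> is the step (1,0).
\<close>

fun step_vec :: "step \<Rightarrow> int \<times> int" where
  "step_vec U = (0, 1)"
| "step_vec D = (1, 0)"

text \<open>The lattice point reached after the first \<open>i\<close> steps of \<open>w\<close>.\<close>

definition point :: "step list \<Rightarrow> nat \<Rightarrow> int \<times> int" where
  "point w i = (\<Sum>j<i. fst (step_vec (w ! j)), \<Sum>j<i. snd (step_vec (w ! j)))"

definition lattice_paths :: "nat \<Rightarrow> step list set" where
  "lattice_paths n = {w. point w (length w) = (int n, int n)}"

text \<open>The step with (zero-based) index \<open>i\<close> goes from \<open>point w i\<close> to \<open>point w (Suc i)\<close>.\<close>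

definition up_steps_below :: "step list \<Rightarrow> nat set" where
  "up_steps_below w =
     {i. i < length w \<and> w ! i = U \<and> snd (point w i) < fst (point w i)}"

definition dyck_paths :: "nat \<Rightarrow> nat \<Rightarrow> step list set" where
  "dyck_paths n m = {w \<in> lattice_paths n. card (up_steps_below w) = m}"

definition peaks :: "step list \<Rightarrow> nat set" where
  "peaks w = {i. Suc i < length w \<and> w ! i = U \<and> w ! Suc i = D}"

definition dyck_paths_peaks :: "nat \<Rightarrow> nat \<Rightarrow> nat \<Rightarrow> step list set" where
  "dyck_paths_peaks n m k = {w \<in> dyck_paths n m. card (peaks w) = k}"

definition dyck_paths_ends :: "step \<Rightarrow> step \<Rightarrow> nat \<Rightarrow> nat \<Rightarrow> nat \<Rightarrow> step list set" where
  "dyck_paths_ends A B n m k =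
     {w \<in> dyck_paths_peaks n m k. w \<noteq> [] \<and> hd w = A \<and> last w = B}"

end

theory Submission
  imports Defs
begin

text \<open>
  Read a path as the sequence of heights \<open>y - x\<close>, and call a balanced word an excursion above
  (below) if its height never becomes negative (positive). Both sides of the claim consist of
  the balanced words whose first and last letters differ and which have \<open>k + 1\<close> cyclic peaks
  when closed up to a circle: a word \<open>D \<dots> U\<close> gains a peak at the seam, a word \<open>U \<dots> D\<close> does not.

  Such a word with \<open>m + 1\<close> up steps below, where \<open>m + 1 < n\<close>, has exactly one factorisation
  \<open>q P D Q U s\<close>, where \<open>q\<close> and \<open>Q\<close> are excursions below, \<open>P\<close> is a nonempty excursion above
  and \<open>s\<close> is balanced: \<open>q\<close> is the longest prefix below the diagonal, \<open>P\<close> the longest one above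
  after it, and \<open>D Q U\<close> is the piece up to the next return. The bijection destroys this
  arch \<open>D Q U\<close>, whose up step lies below, and builds an arch above in its place:
  \<^item> if \<open>s\<close> begins with \<open>D\<close>, the image is \<open>q U D Q P s\<close>; the new peak \<open>U D\<close> replaces the peak
    between \<open>U\<close> and \<open>s\<close>;
  \<^item> otherwise the image is \<open>q U P D Q s\<close>, where no peak appears or disappears;
  \<^item> but if \<open>Q\<close> and \<open>s\<close> are empty, \<open>q\<close> is not, and \<open>q U P D\<close> would both begin and end with \<open>D\<close>;
    the image is then \<open>U D q P\<close> instead. This is where a word \<open>D \<dots> U\<close> with \<open>k\<close> peaks turns
    into a word \<open>U \<dots> D\<close> with \<open>k + 1\<close> peaks.

  After the longest prefix below the diagonal, the second kind of image continues with \<open>U U\<close>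
  and the other two with \<open>U D\<close>; the third kind is then completed by an excursion below and one
  above, after which the first kind still has \<open>s\<close> to come. Hence \<open>q, P, Q, s\<close> can be read off from the image as well.
  The proof takes the quadruples \<open>(q, P, Q, s)\<close> as a common index set for both sides.
\<close>

section \<open>Statistics of words\<close>

fun opp :: "step \<Rightarrow> step" where
  "opp U = D"
| "opp D = U"

lemma opp_neq [simp]: "opp c \<noteq> c" "c \<noteq> opp c"
  by (cases c; simp)+

lemma opp_opp [simp]: "opp (opp c) = c"
  by (cases c; simp)

lemma neq_iff_opp: "x \<noteq> c \<longleftrightarrow> x = opp c"
  by (cases x; cases c; simp)

abbreviation balanced :: "step list \<Rightarrow> bool" where
  "balanced w \<equiv> count_list w U = count_list w D"

abbreviation nbelow :: "step list \<Rightarrow> nat" where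
  "nbelow w \<equiv> card (up_steps_below w)"

abbreviation npeaks :: "step list \<Rightarrow> nat" where
  "npeaks w \<equiv> card (peaks w)"

lemma point_eq_counts:
  "i \<le> length w \<Longrightarrow> point w i = (int (count_list (take i w) D), int (count_list (take i w) U))"
proof (induction i)
  case 0
  then show ?case by (simp add: point_def)
next
  case (Suc i)
  then have "point w i = (int (count_list (take i w) D), int (count_list (take i w) U))"
    by simp
  with Suc.prems show ?case
    by (cases "w ! i") (auto simp: point_def take_Suc_conv_app_nth)
qed

lemma up_steps_below_eq:
  "up_steps_below w =
     {i. i < length w \<and> w ! i = U \<and> count_list (take i w) U < count_list (take i w) D}"
  by (auto simp: up_steps_below_def point_eq_counts)

lemma finite_up_steps_below: "finite (up_steps_below w)"
  by (rule finite_subset[of _ "{..<length w}"]) (auto simp: up_steps_below_def)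

lemma finite_peaks: "finite (peaks w)"
  by (rule finite_subset[of _ "{..<length w}"]) (auto simp: peaks_def)

lemma nbelow_append:
  assumes "balanced u"
  shows "nbelow (u @ v) = nbelow u + nbelow v"
proof -
  let ?sh = "(+) (length u)"
  have "up_steps_below (u @ v) = up_steps_below u \<union> ?sh ` up_steps_below v"
  proof (intro set_eqI)
    fix i
    show "i \<in> up_steps_below (u @ v) \<longleftrightarrow> i \<in> up_steps_below u \<union> ?sh ` up_steps_below v"
    proof (cases "i < length u")
      case True
      then show ?thesis by (auto simp: up_steps_below_eq nth_append)
    next
      case False
      then obtain j where "i = length u + j" by (metis le_Suc_ex not_less)
      then show ?thesis using assms by (auto simp: up_steps_below_eq nth_append)
    qed
  qed
  moreover have "up_steps_below u \<inter> ?sh ` up_steps_below v = {}"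
    by (auto simp: up_steps_below_def)
  ultimately show ?thesis
    by (simp add: card_Un_disjoint finite_up_steps_below card_image)
qed

lemma nbelow_Nil: "nbelow [] = 0"
  by (simp add: up_steps_below_def)

lemma npeaks_Nil: "npeaks [] = 0"
  by (simp add: peaks_def)

lemma npeaks_Cons:
  "npeaks (x # w) = npeaks w + (if x = U \<and> w \<noteq> [] \<and> hd w = D then 1 else 0)"
proof -
  have "peaks (x # w) = Suc ` peaks w \<union> (if x = U \<and> w \<noteq> [] \<and> hd w = D then {0} else {})"
    (is "_ = ?R")
  proof (intro set_eqI)
    fix i
    show "i \<in> peaks (x # w) \<longleftrightarrow> i \<in> ?R"
      by (cases i) (auto simp: peaks_def hd_conv_nth)
  qed
  then show ?thesis
    by (auto simp: card_image finite_peaks)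
qed

lemma npeaks_append:
  "npeaks (u @ v) =
     npeaks u + npeaks v + (if u \<noteq> [] \<and> v \<noteq> [] \<and> last u = U \<and> hd v = D then 1 else 0)"
  by (induction u) (auto simp: npeaks_Nil npeaks_Cons hd_append)

lemma in_dyck_paths_ends_iff:
  "w \<in> dyck_paths_ends A B n m k \<longleftrightarrow>
     count_list w U = n \<and> count_list w D = n \<and> nbelow w = m \<and> npeaks w = k \<and>
     w \<noteq> [] \<and> hd w = A \<and> last w = B"
  by (auto simp: dyck_paths_ends_def dyck_paths_peaks_def dyck_paths_def lattice_paths_def
      point_eq_counts)

section \<open>Excursions and unique factorisation\<close>

text \<open>
  The letter \<open>c\<close> is the direction in which the excursion leaves the diagonal, so that every fact
  is proved at once for Dyck words (\<open>c = U\<close>) and their reflections (\<open>c = D\<close>).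
\<close>

inductive excursion :: "step \<Rightarrow> step list \<Rightarrow> bool" for c where
  Nil: "excursion c []"
| arch: "excursion c a \<Longrightarrow> excursion c b \<Longrightarrow> excursion c (c # a @ opp c # b)"

lemma excursion_count: "excursion c w \<Longrightarrow> count_list w c = count_list w (opp c)"
  by (induction rule: excursion.induct) auto

lemma excursion_balanced: "excursion c w \<Longrightarrow> balanced w"
  using excursion_count[of c w] by (cases c) auto

lemma excursion_prefix:
  "excursion c w \<Longrightarrow> w = u @ v \<Longrightarrow> count_list u (opp c) \<le> count_list u c"
proof (induction arbitrary: u v rule: excursion.induct)
  case Nil
  then show ?case by simp
next
  case (arch a b)
  show ?case
  proof (cases u)
    case Nil
    then show ?thesis by simp
  next
    case (Cons x u')
    with arch.prems have u: "u = c # u'" and eq: "a @ opp c # b = u' @ v" by auto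
    from eq consider z where "a = u' @ z" | z where "u' = a @ z" "opp c # b = z @ v"
      by (auto simp: append_eq_append_conv2)
    then show ?thesis
    proof cases
      case 1
      then show ?thesis using arch.IH(1)[of u'] u by simp
    next
      case (2 z)
      show ?thesis
      proof (cases z)
        case Nil
        then show ?thesis using 2 u excursion_count[OF arch.hyps(1)] by simp
      next
        case (Cons y z')
        with 2 have "z = opp c # z'" "b = z' @ v" by auto
        then show ?thesis using 2 u excursion_count[OF arch.hyps(1)] arch.IH(2)[of z'] by simp
      qed
    qed
  qed
qed

lemma excursion_ends:
  assumes "excursion c w" "w \<noteq> []"
  shows "hd w = c" "last w = opp c"
proof -
  show "hd w = c" using assms by (cases rule: excursion.cases) auto
  have "w = [] \<or> last w = opp c" using assms(1)
    by (induction rule: excursion.induct) auto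
  with assms(2) show "last w = opp c" by simp
qed

lemma nbelow_excursion_U:
  assumes "excursion U w"
  shows "nbelow w = 0"
proof -
  have "\<not> count_list (take i w) U < count_list (take i w) D" for i
    using excursion_prefix[OF assms, of "take i w" "drop i w"] by simp
  then show ?thesis by (simp add: up_steps_below_eq)
qed

lemma count_list_eq_card: "count_list w x = card {i. i < length w \<and> w ! i = x}"
  unfolding count_list_eq_length_filter length_filter_conv_card
  by (rule arg_cong[of _ _ card]) auto

text \<open>
  An up step inside an excursion below ends at height at most zero, so it starts below.
\<close>

lemma nbelow_excursion_D:
  assumes "excursion D w"
  shows "nbelow w = count_list w U"
proof -
  have prefix: "count_list (take j w) U \<le> count_list (take j w) D" for j
    using excursion_prefix[OF assms, of "take j w" "drop j w"] by simp
  have "count_list (take i w) U < count_list (take i w) D" if "i < length w" "w ! i = U" for i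
    using prefix[of "Suc i"] that by (simp add: take_Suc_conv_app_nth)
  then have "up_steps_below w = {i. i < length w \<and> w ! i = U}"
    by (auto simp: up_steps_below_eq)
  then show ?thesis by (simp add: count_list_eq_card)
qed

text \<open>
  A longer excursion could not continue a shorter one by the letter \<open>opp c\<close>, since this letter
  crosses the diagonal. With \<open>v\<close> starting with \<open>opp c\<close> this gives uniqueness both of the longest
  excursion and of the inner part of an arch.
\<close>

lemma excursion_prefix_unique:
  assumes "excursion c q" "excursion c q'" "q @ v = q' @ v'"
    and "v = [] \<or> hd v = opp c" "v' = [] \<or> hd v' = opp c"
  shows "q = q' \<and> v = v'"
proof -
  have no_longer: "z = []"
    if "excursion c p" "excursion c (p @ z)" "z @ y = x" "x = [] \<or> hd x = opp c" for p z x y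
  proof (rule ccontr)
    assume "z \<noteq> []"
    with that have "z = opp c # tl z" by (cases z) auto
    then have "p @ z = (p @ [opp c]) @ tl z" by simp
    from excursion_prefix[OF that(2) this] excursion_count[OF that(1)] show False by simp
  qed
  from assms(3) consider z where "q = q' @ z" "z @ v = v'" | z where "q' = q @ z" "v = z @ v'"
    by (auto simp: append_eq_append_conv2)
  then show ?thesis
  proof cases
    case 1
    have "z = []"
      using no_longer[OF assms(2) assms(1)[unfolded 1(1)] 1(2) assms(5)] .
    with 1 show ?thesis by simp
  next
    case 2
    have "z = []"
      using no_longer[OF assms(1) assms(2)[unfolded 2(1)] 2(2)[symmetric] assms(4)] .
    with 2 show ?thesis by simp
  qed
qed

lemma first_passage:
  "count_list w c < count_list w (opp c) \<Longrightarrow> \<exists>a b. w = a @ opp c # b \<and> excursion c a"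
proof (induction w rule: length_induct)
  case (1 w)
  show ?case
  proof (cases w)
    case Nil
    with 1 show ?thesis by simp
  next
    case (Cons x w')
    show ?thesis
    proof (cases "x = c")
      case False
      with Cons show ?thesis by (auto simp: neq_iff_opp intro: exI[of _ "[]"] excursion.Nil)
    next
      case True
      with 1 Cons obtain a b where ab: "w' = a @ opp c # b" "excursion c a"
        by auto
      with 1 Cons True have "count_list b c < count_list b (opp c)"
        using excursion_count[of c a] by simp
      moreover have "length b < length w" using ab Cons by simp
      ultimately obtain a' b' where "b = a' @ opp c # b'" "excursion c a'"
        using "1.IH" by blast
      with ab Cons True show ?thesis
        by (intro exI[of _ "c # a @ opp c # a'"] exI[of _ b']) (auto intro: excursion.arch)
    qed
  qed
qed

lemma first_return:
  assumes "balanced (c # w)"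
  obtains a b where "w = a @ opp c # b" "excursion c a" "balanced b"
proof -
  have "count_list w c < count_list w (opp c)" using assms by (cases c) auto
  then obtain a b where "w = a @ opp c # b" "excursion c a" using first_passage by blast
  with assms excursion_balanced[of c a] that show thesis by (cases c) auto
qed

lemma longest_excursion_prefix:
  assumes "balanced w"
  obtains q v where "w = q @ v" "excursion c q" "balanced v" "v = [] \<or> hd v = opp c"
proof -
  have "\<exists>q v. w = q @ v \<and> excursion c q \<and> balanced v \<and> (v = [] \<or> hd v = opp c)"
    using assms
  proof (induction w rule: length_induct)
    case (1 w)
    show ?case
    proof (cases "w = [] \<or> hd w = opp c")
      case True
      with 1 show ?thesis by (auto intro: exI[of _ "[]"] excursion.Nil)
    next
      case False
      then obtain w' where w: "w = c # w'" by (cases w) (auto simp: neq_iff_opp)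
      with 1 obtain a b where ab: "w' = a @ opp c # b" "excursion c a" "balanced b"
        using first_return by metis
      moreover have "length b < length w" using ab w by simp
      ultimately obtain q v where
        "b = q @ v" "excursion c q" "balanced v" "v = [] \<or> hd v = opp c"
        using "1.IH" by blast
      with ab w show ?thesis
        by (intro exI[of _ "c # a @ opp c # q"] exI[of _ v]) (auto intro: excursion.arch)
    qed
  qed
  with that show thesis by blast
qed

lemma excursion_arch_U: "excursion U a \<Longrightarrow> excursion U (U # a @ [D])"
  using excursion.arch[of U a "[]"] by (simp add: excursion.Nil)

lemma excursion_arch_D: "excursion D a \<Longrightarrow> excursion D (D # a @ [U])"
  using excursion.arch[of D a "[]"] by (simp add: excursion.Nil)

section \<open>The exchange of an arch below for an arch above\<close>

type_synonym parts = "step list \<times> step list \<times> step list \<times> step list"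

definition parts :: "parts set" where
  "parts = {(q, P, Q, s).
     excursion D q \<and> excursion U P \<and> P \<noteq> [] \<and> excursion D Q \<and> balanced s}"

fun with_arch_below :: "parts \<Rightarrow> step list" where
  "with_arch_below (q, P, Q, s) = q @ P @ D # Q @ U # s"

fun with_arch_above :: "parts \<Rightarrow> step list" where
  "with_arch_above (q, P, Q, s) =
     (if s \<noteq> [] \<and> hd s = D then q @ U # D # Q @ P @ s
      else if Q = [] \<and> s = [] then U # D # q @ P
      else q @ U # P @ D # Q @ s)"

text \<open>
  Equivalently, the balanced words with \<open>k + 1\<close> cyclic peaks that turn at the seam.
\<close>

definition turning_paths :: "nat \<Rightarrow> nat \<Rightarrow> nat \<Rightarrow> step list set" where
  "turning_paths n m k = dyck_paths_ends D U n m k \<union> dyck_paths_ends U D n m (k + 1)"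

lemma nbelow_with_arch_below:
  assumes "(q, P, Q, s) \<in> parts"
  shows "nbelow (with_arch_below (q, P, Q, s)) =
    count_list q U + count_list Q U + 1 + nbelow s"
proof -
  have *: "excursion D q" "excursion U P" "excursion D (D # Q @ [U])"
    using assms by (auto simp: parts_def excursion_arch_D)
  have "with_arch_below (q, P, Q, s) = q @ P @ (D # Q @ [U]) @ s"
    by simp
  also have "nbelow \<dots> = nbelow q + (nbelow P + (nbelow (D # Q @ [U]) + nbelow s))"
    using *[THEN excursion_balanced] by (simp only: nbelow_append)
  finally show ?thesis
    by (simp add: nbelow_excursion_U nbelow_excursion_D *)
qed

lemma nbelow_with_arch_above:
  assumes "(q, P, Q, s) \<in> parts"
  shows "nbelow (with_arch_above (q, P, Q, s)) =
    count_list q U + count_list Q U + nbelow s"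
proof -
  have *: "excursion D q" "excursion U P" "excursion D Q" "excursion U [U, D]"
      "excursion U (U # P @ [D])"
    using assms excursion_arch_U[of "[]"]
    by (auto simp: parts_def excursion_arch_U excursion.Nil)
  note bal = *[THEN excursion_balanced]
  note stat = nbelow_excursion_U nbelow_excursion_D *
  have "nbelow (q @ [U, D] @ Q @ P @ s) =
      nbelow q + (nbelow [U, D] + (nbelow Q + (nbelow P + nbelow s)))"
    using bal by (simp only: nbelow_append)
  then have 1: "nbelow (q @ U # D # Q @ P @ s) = count_list q U + count_list Q U + nbelow s"
    by (simp add: stat)
  have "nbelow ([U, D] @ q @ P) = nbelow [U, D] + (nbelow q + nbelow P)"
    using bal by (simp only: nbelow_append)
  then have 2: "nbelow (U # D # q @ P) = count_list q U"
    by (simp add: stat)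
  have "nbelow (q @ (U # P @ [D]) @ Q @ s) =
      nbelow q + (nbelow (U # P @ [D]) + (nbelow Q + nbelow s))"
    using bal by (simp only: nbelow_append)
  then have 3: "nbelow (q @ U # P @ D # Q @ s) = count_list q U + count_list Q U + nbelow s"
    by (simp add: stat)
  from 1 2 3 show ?thesis by (cases "s = []") (simp_all add: nbelow_Nil)
qed

text \<open>
  The assumption \<open>1 \<le> m\<close> makes \<open>q\<close> nonempty in the exceptional case \<open>Q = s = []\<close>, since all of the
  up steps below then lie in \<open>q\<close>, apart from the one of the arch; so \<open>q P D U\<close> begins with \<open>D\<close>.
\<close>

lemma with_arch_below_in_iff_above_in:
  assumes t: "t \<in> parts" and m: "1 \<le> m"
  shows "with_arch_below t \<in> turning_paths n (m + 1) k \<longleftrightarrow>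
    with_arch_above t \<in> turning_paths n m k"
proof -
  obtain q P Q s where t_eq: "t = (q, P, Q, s)" by (cases t)
  have exc: "excursion D q" "excursion U P" "P \<noteq> []" "excursion D Q" "balanced s"
    using t by (auto simp: t_eq parts_def)
  have counts: "count_list (with_arch_above t) x = count_list (with_arch_below t) x" for x
    using exc(5) by (cases x) (auto simp: t_eq)
  have below: "nbelow (with_arch_below t) = nbelow (with_arch_above t) + 1"
    using nbelow_with_arch_below nbelow_with_arch_above t unfolding t_eq by simp
  have q: "q = [] \<or> hd q = D \<and> last q = U"
    and P: "hd P = U" "last P = D"
    and Q: "Q = [] \<or> hd Q = D \<and> last Q = U"
    using excursion_ends[of D q] excursion_ends[of U P] excursion_ends[of D Q] exc by auto
  note peaks = npeaks_append npeaks_Cons npeaks_Nil hd_append last_append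
  show ?thesis
  proof (cases "Q = [] \<and> s = []")
    case True
    have "q \<noteq> []" if "nbelow (with_arch_above t) = m"
      using that m nbelow_with_arch_above[of q P Q s] t True nbelow_Nil by (auto simp: t_eq)
    with True q P exc(3) below counts show ?thesis
      by (auto simp: turning_paths_def in_dyck_paths_ends_iff t_eq peaks)
  next
    case False
    have "hd (with_arch_above t) = hd (with_arch_below t)"
      using False q P exc(3) by (auto simp: t_eq hd_append)
    moreover have "last (with_arch_above t) = last (with_arch_below t)"
      using False q P Q exc(3) by (auto simp: t_eq last_append)
    moreover have "npeaks (with_arch_above t) = npeaks (with_arch_below t)"
      using False q P Q exc(3) step.exhaust[of "hd s"] by (auto simp: t_eq peaks)
    moreover have "with_arch_above t \<noteq> []" "with_arch_below t \<noteq> []"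
      using False by (auto simp: t_eq)
    ultimately show ?thesis
      using below counts by (auto simp: turning_paths_def in_dyck_paths_ends_iff)
  qed
qed

section \<open>Both sides are indexed by the same quadruples\<close>

lemma inj_with_arch_below: "inj_on with_arch_below parts"
proof (rule inj_onI)
  fix t t' assume tt': "t \<in> parts" "t' \<in> parts" "with_arch_below t = with_arch_below t'"
  obtain q P Q s where t: "t = (q, P, Q, s)" by (cases t)
  obtain q' P' Q' s' where t': "t' = (q', P', Q', s')" by (cases t')
  have exc: "excursion D q" "excursion U P" "P \<noteq> []" "excursion D Q"
      "excursion D q'" "excursion U P'" "P' \<noteq> []" "excursion D Q'"
    using tt' by (auto simp: t t' parts_def)
  have hd: "hd P = U" "hd P' = U"
    using exc excursion_ends[of U] by auto
  have 1: "q = q' \<and> P @ D # Q @ U # s = P' @ D # Q' @ U # s'"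
    using tt'(3) by (intro excursion_prefix_unique[of D]) (simp_all add: t t' exc hd)
  then have 2: "P = P' \<and> D # Q @ U # s = D # Q' @ U # s'"
    by (intro excursion_prefix_unique[of U]) (simp_all add: exc)
  then have "Q = Q' \<and> U # s = U # s'"
    by (intro excursion_prefix_unique[of D]) (simp_all add: exc)
  with 1 2 show "t = t'" by (simp add: t t')
qed

text \<open>
  After the longest prefix below, \<open>U U\<close> signals the image \<open>q U P D Q s\<close> and \<open>U D\<close> one of the
  other two. Those are separated by stripping an excursion below and then one above: what
  remains is \<open>s\<close>, which is nonempty in \<open>q U D Q P s\<close>, and nothing in \<open>U D q P\<close>.
\<close>

lemma inj_with_arch_above: "inj_on with_arch_above parts"
proof (rule inj_onI)
  fix t t' assume tt': "t \<in> parts" "t' \<in> parts" "with_arch_above t = with_arch_above t'"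
  obtain q P Q s where t: "t = (q, P, Q, s)" by (cases t)
  obtain q' P' Q' s' where t': "t' = (q', P', Q', s')" by (cases t')
  have exc: "excursion D q" "excursion U P" "P \<noteq> []" "excursion D Q"
      "excursion D q'" "excursion U P'" "P' \<noteq> []" "excursion D Q'"
    using tt' by (auto simp: t t' parts_def)
  have hd: "hd P = U" "hd P' = U"
    using exc excursion_ends[of U] by auto
  \<comment> \<open>The exceptional words get an empty leading excursion below, so that all three shapes are
    a leading excursion below followed by a word that starts with \<open>U\<close>.\<close>
  define lead :: "parts \<Rightarrow> step list" where
    "lead = (\<lambda>(q, P, Q, s). if Q = [] \<and> s = [] then [] else q)"
  define rest :: "parts \<Rightarrow> step list" where
    "rest = (\<lambda>(q, P, Q, s).
       if s \<noteq> [] \<and> hd s = D then D # Q @ P @ s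
       else if Q = [] \<and> s = [] then D # q @ P
       else P @ D # Q @ s)"
  have split: "with_arch_above x = lead x @ U # rest x" for x
    by (cases x) (auto simp: lead_def rest_def)
  have "excursion D (lead t)" "excursion D (lead t')"
    using exc by (auto simp: t t' lead_def excursion.Nil)
  then have "lead t = lead t' \<and> U # rest t = U # rest t'"
    using tt'(3) by (intro excursion_prefix_unique[of D]) (simp_all add: split)
  then have lead: "lead t = lead t'" and rest: "rest t = rest t'" by auto
  have hd_P: "hd (P @ x) = U" "hd (P' @ x) = U" for x
    using exc hd by (simp_all add: hd_append)
  have strip: "a = a' \<and> R = R' \<and> x = x'"
    if "a @ R @ x = a' @ R' @ x'" "excursion D a" "excursion D a'"
      "R \<in> {P, P'}" "R' \<in> {P, P'}" "x = [] \<or> hd x = D" "x' = [] \<or> hd x' = D"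
    for a a' R R' x x'
  proof -
    have R: "excursion U R" "excursion U R'" "R \<noteq> []" "R' \<noteq> []" "hd R = U" "hd R' = U"
      using that exc hd by auto
    have 1: "a = a' \<and> R @ x = R' @ x'"
      using that by (intro excursion_prefix_unique[of D]) (simp_all add: R)
    then have "R = R' \<and> x = x'"
      using that by (intro excursion_prefix_unique[of U]) (simp_all add: R)
    with 1 show ?thesis by simp
  qed
  have U_iff: "hd z \<noteq> D \<longleftrightarrow> hd z = U" for z :: "step list"
    by (simp add: neq_iff_opp)
  consider (peak) "s \<noteq> []" "hd s = D" | (exceptional) "Q = []" "s = []"
    | (wrap) "\<not> (Q = [] \<and> s = [])" "s = [] \<or> hd s = U"
    using U_iff by blast
  then show "t = t'"
  proof cases
    case peak
    then have r: "rest t = D # Q @ P @ s" by (simp add: t rest_def)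
    consider (a) "s' \<noteq> []" "hd s' = D" | (b) "Q' = []" "s' = []"
      | (c) "\<not> (Q' = [] \<and> s' = [])" "s' = [] \<or> hd s' = U"
      using U_iff by blast
    then show ?thesis
    proof cases
      case a
      with r rest have "Q @ P @ s = Q' @ P' @ s'" by (simp add: t' rest_def)
      then have "Q = Q' \<and> P = P' \<and> s = s'" using strip[of Q P s Q' P' s'] a peak exc by simp
      with lead a peak show ?thesis by (simp add: t t' lead_def)
    next
      case b
      with r rest have "Q @ P @ s = q' @ P' @ []" by (simp add: t' rest_def)
      then have "s = []" using strip[of Q P s q' P' "[]"] peak exc by simp
      with peak show ?thesis by simp
    next
      case c
      then have "rest t' = P' @ D # Q' @ s'" by (auto simp: t' rest_def)
      with r rest hd_P(2)[of "D # Q' @ s'"] show ?thesis by simp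
    qed
  next
    case exceptional
    then have r: "rest t = D # q @ P @ []" by (simp add: t rest_def)
    consider (a) "s' \<noteq> []" "hd s' = D" | (b) "Q' = []" "s' = []"
      | (c) "\<not> (Q' = [] \<and> s' = [])" "s' = [] \<or> hd s' = U"
      using U_iff by blast
    then show ?thesis
    proof cases
      case a
      with r rest have "q @ P @ [] = Q' @ P' @ s'" by (simp add: t' rest_def)
      then have "s' = []" using strip[of q P "[]" Q' P' s'] a exc by simp
      with a show ?thesis by simp
    next
      case b
      with r rest have "q @ P @ [] = q' @ P' @ []" by (simp add: t' rest_def)
      then have "q = q' \<and> P = P'" using strip[of q P "[]" q' P' "[]"] exc by simp
      with b exceptional show ?thesis by (simp add: t t')
    next
      case c
      then have "rest t' = P' @ D # Q' @ s'" by (auto simp: t' rest_def)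
      with r rest hd_P(2)[of "D # Q' @ s'"] show ?thesis by simp
    qed
  next
    case wrap
    then have r: "rest t = P @ D # Q @ s" by (auto simp: t rest_def)
    then have "hd (rest t') = U" using rest hd_P(1) by simp
    then have c: "\<not> (Q' = [] \<and> s' = [])" "s' = [] \<or> hd s' = U"
      using U_iff[of s'] by (auto simp: t' rest_def split: if_splits)
    with r rest have "P @ D # Q @ s = P' @ D # Q' @ s'" by (auto simp: t' rest_def)
    then have 1: "P = P' \<and> D # Q @ s = D # Q' @ s'"
      by (intro excursion_prefix_unique[of U]) (simp_all add: exc)
    then have "Q = Q' \<and> s = s'"
      using wrap c by (intro excursion_prefix_unique[of D]) (simp_all add: exc)
    with 1 lead wrap show ?thesis by (auto simp: t t' lead_def)
  qed
qed

lemma turning_paths_basic: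
  assumes "w \<in> turning_paths n m k"
  shows "balanced w" "count_list w U = n" "nbelow w = m" "w \<noteq> []" "hd w = opp (last w)"
  using assms by (auto simp: turning_paths_def in_dyck_paths_ends_iff)

text \<open>
  A word has no factorisation \<open>q P D Q U s\<close> if it never leaves one side of the diagonal or if
  it is of the form \<open>q P\<close>. In the former case none or all of its up steps lie below, against the
  bounds on \<open>m\<close>; in the latter it begins and ends with \<open>D\<close>.
\<close>

lemma ex_with_arch_below:
  assumes w: "w \<in> turning_paths n m k" and m: "1 \<le> m" "m < n"
  shows "\<exists>t\<in>parts. w = with_arch_below t"
proof -
  note w = turning_paths_basic[OF w]
  obtain q v where q: "w = q @ v" "excursion D q" "balanced v" "v = [] \<or> hd v = opp D"
    using longest_excursion_prefix[OF w(1)] .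
  obtain P v' where P: "v = P @ v'" "excursion U P" "balanced v'" "v' = [] \<or> hd v' = opp U"
    using longest_excursion_prefix[OF q(3)] .
  have "v \<noteq> []" using q(1) w(2,3) m nbelow_excursion_D[OF q(2)] by auto
  then have P_ne: "P \<noteq> []" using P q(4) by (cases P) auto
  then have P_ends: "hd P = U" "last P = D" using excursion_ends[OF P(2)] by auto
  have "v' \<noteq> []"
  proof
    assume "v' = []"
    then have w_eq: "w = q @ P" using q(1) P(1) by simp
    then have "last w = D" using P_ne P_ends by simp
    then have "hd w = U" using w(5) by simp
    then have "q = []" using excursion_ends(1)[OF q(2)] w_eq by (cases q) auto
    then show False using w_eq w(3) m nbelow_excursion_U[OF P(2)] by simp
  qed
  with P(4) obtain r where r: "v' = D # r" by (cases v') auto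
  with P(3) obtain Q s where "r = Q @ opp D # s" "excursion D Q" "balanced s"
    using first_return[of D r] by auto
  with q P P_ne r have "(q, P, Q, s) \<in> parts" "w = with_arch_below (q, P, Q, s)"
    by (auto simp: parts_def)
  then show ?thesis by blast
qed

text \<open>
  The bound \<open>m + 2 \<le> n\<close> excludes a word \<open>q U D Q\<close>, which has just one up step that is not
  below and does not arise from any quadruple.
\<close>

lemma ex_with_arch_above:
  assumes w: "w \<in> turning_paths n m k" and m: "1 \<le> m" "m + 2 \<le> n"
  shows "\<exists>t\<in>parts. w = with_arch_above t"
proof -
  note w = turning_paths_basic[OF w]
  obtain q v where q: "w = q @ v" "excursion D q" "balanced v" "v = [] \<or> hd v = opp D"
    using longest_excursion_prefix[OF w(1)] .
  have q_hd: "q = [] \<or> hd w = D" using excursion_ends(1)[of D q] q by (cases q) auto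
  have "v \<noteq> []" using q(1) w(2,3) m nbelow_excursion_D[OF q(2)] by auto
  then obtain r where r: "v = U # r" using q(4) by (cases v) auto
  with q(3) obtain P' v' where P': "r = P' @ D # v'" "excursion U P'" "balanced v'"
    using first_return[of U r] by auto
  obtain Q y where Q: "v' = Q @ y" "excursion D Q" "balanced y" "y = [] \<or> hd y = opp D"
    using longest_excursion_prefix[OF P'(3)] .
  have w_eq: "w = q @ U # P' @ D # Q @ y" using q r P' Q by simp
  show ?thesis
  proof (cases "P' = []")
    case False
    have "\<not> (Q = [] \<and> y = [])"
    proof
      assume "Q = [] \<and> y = []"
      then have "w = q @ (U # P' @ [D])" using w_eq by simp
      moreover from this w(5) q_hd have "q = []" by auto
      ultimately have "nbelow w = 0" using nbelow_excursion_U[OF excursion_arch_U[OF P'(2)]]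
        by simp
      with w(3) m show False by simp
    qed
    with Q(4) w_eq have "w = with_arch_above (q, P', Q, y)" by auto
    moreover have "(q, P', Q, y) \<in> parts" using q P' Q False by (auto simp: parts_def)
    ultimately show ?thesis by blast
  next
    case True
    obtain P s where P: "y = P @ s" "excursion U P" "balanced s" "s = [] \<or> hd s = opp U"
      using longest_excursion_prefix[OF Q(3)] .
    have UD: "excursion U [U, D]" using excursion_arch_U[of "[]"] by (simp add: excursion.Nil)
    have "y \<noteq> []"
    proof
      assume "y = []"
      with w_eq True have w': "w = q @ [U, D] @ Q" by simp
      have "nbelow w = nbelow q + (nbelow [U, D] + nbelow Q)"
        unfolding w' using q(2) UD by (simp only: nbelow_append excursion_balanced)
      then have "nbelow w = count_list q U + count_list Q U"
        using nbelow_excursion_D[OF q(2)] nbelow_excursion_U[OF UD] nbelow_excursion_D[OF Q(2)]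
        by simp
      moreover have "count_list w U = count_list q U + 1 + count_list Q U"
        unfolding w' by simp
      ultimately show False using w(2,3) m by simp
    qed
    then have P_ne: "P \<noteq> []" using P Q(4) by (cases P) auto
    then have P_ends: "hd P = U" "last P = D" using excursion_ends[OF P(2)] by auto
    show ?thesis
    proof (cases "s = []")
      case False
      with P have "w = with_arch_above (q, P, Q, s)" using w_eq True by auto
      moreover have "(q, P, Q, s) \<in> parts" using q Q P P_ne by (auto simp: parts_def)
      ultimately show ?thesis by blast
    next
      case s: True
      with P w_eq True have w': "w = q @ U # D # Q @ P" by simp
      with P_ne P_ends w(5) q_hd have "q = []" by (auto simp: last_append)
      \<comment> \<open>The excursion below that follows the first peak plays the role of \<open>q\<close> here.\<close>
      with w' have "w = with_arch_above (Q, P, [], [])" by simp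
      moreover have "(Q, P, [], []) \<in> parts" using Q P P_ne
        by (auto simp: parts_def excursion.Nil)
      ultimately show ?thesis by blast
    qed
  qed
qed

theorem theorem5:
  fixes n m k :: nat
  assumes "1 \<le> m" and "m + 2 \<le> n"
    and "1 \<le> k" and "k + 1 \<le> n"
  shows "\<exists>\<Phi>. bij_betw \<Phi>
           (dyck_paths_ends D U n (m + 1) k \<union> dyck_paths_ends U D n (m + 1) (k + 1))
           (dyck_paths_ends D U n m k \<union> dyck_paths_ends U D n m (k + 1))"
proof -
  define X where "X = {t \<in> parts. with_arch_below t \<in> turning_paths n (m + 1) k}"
  have X': "X = {t \<in> parts. with_arch_above t \<in> turning_paths n m k}"
    using with_arch_below_in_iff_above_in assms(1) by (auto simp: X_def)
  have "with_arch_below ` X = turning_paths n (m + 1) k"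
    using ex_with_arch_below[of _ n "m + 1" k] assms by (auto simp: X_def)
  moreover have "inj_on with_arch_below X"
    using inj_with_arch_below by (rule inj_on_subset) (auto simp: X_def)
  ultimately have below: "bij_betw with_arch_below X (turning_paths n (m + 1) k)"
    by (simp add: bij_betw_def)
  have "with_arch_above ` X = turning_paths n m k"
    using ex_with_arch_above[of _ n m k] assms by (auto simp: X')
  moreover have "inj_on with_arch_above X"
    using inj_with_arch_above by (rule inj_on_subset) (auto simp: X_def)
  ultimately have above: "bij_betw with_arch_above X (turning_paths n m k)"
    by (simp add: bij_betw_def)
  show ?thesis
    using bij_betw_trans[OF bij_betw_inv_into[OF below] above]
    unfolding turning_paths_def by blast
qed

end
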